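(* Consider the statistic $Y^{\mathrm{dif}}_t$ of the inverse transform watermark. Under $H_0$, $$\lim_{|\mathcal{W}|\to\infty}\mathbb{P}_{H_0}(Y^{\mathrm{dif}}_t\le r)=1-(1-r)^2\qquad\text{for any } r\in[0,1].$$ Under $H_1$, let $\Delta\in[0,1)$ and consider a sequence of NTP distributions $\boldsymbol{P}_t$ indexed by $|\mathcal{W}|$ such that $\lim_{|\mathcal{W}|\to\infty}P_{t,(1)}=1-\Delta$ and $\lim_{|\mathcal{W}|\to\infty}\log|\mathcal{W}|\cdot P_{t,(2)}=0$. Then $$\lim_{|\mathcal{W}|\to\infty}\mathbb{P}_{H_1}(Y^{\mathrm{dif}}_t\le r\mid\boldsymbol{P}_t)=1-\Big(1-\frac{r}{1-\Delta}\Big)^2\qquad\text{for any } r\in[0,1-\Delta].$$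
   Context: The vocabulary is $\mathcal{W}=\{1,\dots,|\mathcal{W}|\}$ with $|\mathcal{W}|\ge2$; an NTP distribution is a probability vector $\boldsymbol{P}_t=(P_{t,w})_{w\in\mathcal{W}}$, and $P_{t,(i)}$ denotes its $i$-th largest coordinate (with multiplicity). Let $U_t\sim U(0,1)$ and let $\pi_t$ be a uniformly random permutation of $\mathcal{W}$, independent of $U_t$. Under $H_0$ (human-written text) the token $w_t$ is independent of $(U_t,\pi_t)$. Under $H_1$ (inverse transform watermark) $w_t=\pi_t^{-1}(F^{-1}(U_t;\pi_t))$, where $F^{-1}(U;\pi)=\min\{i:\sum_{w'\in\mathcal{W}}P_{t,w'}\mathbf{1}_{\{\pi(w')\le i\}}\ge U\}$. Define $\eta(i)=\frac{i-1}{|\mathcal{W}|-1}$ and $Y^{\mathrm{dif}}_t=|U_t-\eta(\pi_t(w_t))|$. $\mathbb{P}_{H_1}(\cdot\mid\boldsymbol{P}_t)$ is the law when the NTP distribution is $\boldsymbol{P}_t$. *)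

theory Defs
  imports "HOL-Probability.Probability" "HOL-Combinatorics.Permutations"
begin

text \<open>The vocabulary of size \<open>n\<close> is \<open>{1..n}\<close>; distributions and permutations are functions on
  \<open>nat\<close> of which only the behaviour on \<open>{1..n}\<close> matters.\<close>

definition ntp_dist :: "nat \<Rightarrow> (nat \<Rightarrow> real) \<Rightarrow> bool" where
  "ntp_dist n P \<longleftrightarrow> (\<forall>w\<in>{1..n}. 0 \<le> P w) \<and> (\<Sum>w\<in>{1..n}. P w) = 1"

text \<open>The \<open>i\<close>-th largest coordinate, counted with multiplicity, for \<open>1 \<le> i \<le> n\<close>.\<close>

definition kth_largest :: "nat \<Rightarrow> (nat \<Rightarrow> real) \<Rightarrow> nat \<Rightarrow> real" where
  "kth_largest n P i = rev (sort (map P [1..<Suc n])) ! (i - 1)"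

definition perms :: "nat \<Rightarrow> (nat \<Rightarrow> nat) set" where
  "perms n = {\<pi>. \<pi> permutes {1..n}}"

text \<open>For \<open>u \<in> (0,1)\<close> and \<open>\<pi> \<in> perms n\<close> the set below is nonempty (it contains \<open>n\<close>). Restricting
  \<open>i\<close> to \<open>{1..n}\<close> loses nothing there, since for \<open>i = 0\<close> the sum vanishes.\<close>

definition inv_cdf :: "nat \<Rightarrow> (nat \<Rightarrow> real) \<Rightarrow> real \<Rightarrow> (nat \<Rightarrow> nat) \<Rightarrow> nat" where
  "inv_cdf n P u \<pi> = Min {i \<in> {1..n}. (\<Sum>w\<in>{1..n}. P w * of_bool (\<pi> w \<le> i)) \<ge> u}"

definition watermark_token :: "nat \<Rightarrow> (nat \<Rightarrow> real) \<Rightarrow> real \<Rightarrow> (nat \<Rightarrow> nat) \<Rightarrow> nat" where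
  "watermark_token n P u \<pi> = inv \<pi> (inv_cdf n P u \<pi>)"

definition eta :: "nat \<Rightarrow> nat \<Rightarrow> real" where
  "eta n i = (real i - 1) / (real n - 1)"

definition Y_dif :: "nat \<Rightarrow> real \<Rightarrow> (nat \<Rightarrow> nat) \<Rightarrow> nat \<Rightarrow> real" where
  "Y_dif n u \<pi> w = \<bar>u - eta n (\<pi> w)\<bar>"

text \<open>The library's \<open>indep_var\<close> requires both variables to have the same value type; this is
  independence of random variables with values of different types.\<close>

definition indep_rv ::
  "'a measure \<Rightarrow> 'b measure \<Rightarrow> ('a \<Rightarrow> 'b) \<Rightarrow> 'c measure \<Rightarrow> ('a \<Rightarrow> 'c) \<Rightarrow> bool" where
  "indep_rv M S X T Y \<longleftrightarrow>
     X \<in> measurable M S \<and> Y \<in> measurable M T \<and>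
     prob_space.indep_set M
       {X -` A \<inter> space M | A. A \<in> sets S} {Y -` B \<inter> space M | B. B \<in> sets T}"

definition pseudorandom ::
  "nat \<Rightarrow> 'a measure \<Rightarrow> ('a \<Rightarrow> real) \<Rightarrow> ('a \<Rightarrow> nat \<Rightarrow> nat) \<Rightarrow> bool" where
  "pseudorandom n M U \<pi> \<longleftrightarrow>
     prob_space M \<and>
     U \<in> borel_measurable M \<and>
     distr M borel U = uniform_measure lborel {0<..<1} \<and>
     \<pi> \<in> measurable M (count_space (perms n)) \<and>
     distr M (count_space (perms n)) \<pi> = uniform_count_measure (perms n) \<and>
     indep_rv M borel U (count_space (perms n)) \<pi>"

text \<open>The law of the human-written token is unrestricted.\<close>

definition model_H0 ::
  "nat \<Rightarrow> 'a measure \<Rightarrow> ('a \<Rightarrow> real) \<Rightarrow> ('a \<Rightarrow> nat \<Rightarrow> nat) \<Rightarrow> ('a \<Rightarrow> nat) \<Rightarrow> bool" where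
  "model_H0 n M U \<pi> w \<longleftrightarrow>
     pseudorandom n M U \<pi> \<and>
     w \<in> measurable M (count_space {1..n}) \<and>
     indep_rv M (count_space {1..n}) w
       (borel \<Otimes>\<^sub>M count_space (perms n)) (\<lambda>\<omega>. (U \<omega>, \<pi> \<omega>))"

definition model_H1 ::
  "nat \<Rightarrow> (nat \<Rightarrow> real) \<Rightarrow> 'a measure \<Rightarrow> ('a \<Rightarrow> real) \<Rightarrow> ('a \<Rightarrow> nat \<Rightarrow> nat) \<Rightarrow> ('a \<Rightarrow> nat) \<Rightarrow> bool"
where
  "model_H1 n P M U \<pi> w \<longleftrightarrow>
     pseudorandom n M U \<pi> \<and>
     (\<forall>\<omega>\<in>space M. w \<omega> = watermark_token n P (U \<omega>) (\<pi> \<omega>))"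

definition cdf_Y_dif ::
  "nat \<Rightarrow> 'a measure \<Rightarrow> ('a \<Rightarrow> real) \<Rightarrow> ('a \<Rightarrow> nat \<Rightarrow> nat) \<Rightarrow> ('a \<Rightarrow> nat) \<Rightarrow> real \<Rightarrow> real" where
  "cdf_Y_dif n M U \<pi> w r = measure M {\<omega> \<in> space M. Y_dif n (U \<omega>) (\<pi> \<omega>) (w \<omega>) \<le> r}"

end

theory Submission
  imports Defs
begin

text \<open>Condition on \<open>U = u\<close>. With \<open>F j\<close> the mass of the tokens of rank at most \<open>j\<close>, the event
  \<open>Y \<le> r\<close> reads \<open>F (lo u) < u \<le> F (hi u)\<close>, where \<open>hi u / n\<close> and \<open>lo u / n\<close> tend to \<open>min 1 (u + r)\<close>
  and \<open>max 0 (u - r)\<close>. For \<open>j / n \<longlonglongrightarrow> a\<close>, the top token contributes to \<open>F j\<close> the amount \<open>1 - \<Delta>\<close> with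
  probability tending to \<open>a\<close>, while the variance of the remaining contribution is at most the
  second largest probability, so that this contribution concentrates at \<open>\<Delta> a\<close>. Hence the
  probability of \<open>u \<le> F j\<close> tends to \<open>1\<close>, \<open>a\<close> or \<open>0\<close> according to the position of \<open>u\<close> relative to
  \<open>\<Delta> a\<close> and \<open>\<Delta> a + (1 - \<Delta>)\<close>, and dominated convergence reduces the claim to integrating a
  piecewise linear function of \<open>u\<close>. The null hypothesis behaves like the case of a
  deterministic next token, where \<open>\<Delta> = 0\<close>.\<close>

section \<open>Uniformly random permutations\<close>

text \<open>Keeps the literal \<open>1\<close> in \<open>{1..n}\<close> from being rewritten to
  \<open>Suc 0\<close>.\<close>

declare One_nat_def [simp del]

abbreviation rperm :: "nat \<Rightarrow> (nat \<Rightarrow> nat) pmf" where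
  "rperm n \<equiv> pmf_of_set (perms n)"

lemma finite_perms [simp]: "finite (perms n)"
  by (simp add: perms_def finite_permutations)

lemma perms_nonempty [simp]: "perms n \<noteq> {}"
  using permutes_id[of "{1..n}"] unfolding perms_def by blast

lemma set_rperm [simp]: "set_pmf (rperm n) = perms n"
  by (simp add: set_pmf_of_set)

lemma integrable_rperm [simp]:
  "integrable (measure_pmf (rperm n)) (f :: _ \<Rightarrow> real)"
  by (intro integrable_measure_pmf_finite) simp

lemma expectation_rperm_cong:
  fixes f :: "(nat \<Rightarrow> nat) \<Rightarrow> real"
  assumes "\<And>\<sigma>. \<sigma> \<in> perms n \<Longrightarrow> f \<sigma> = g \<sigma>"
  shows "measure_pmf.expectation (rperm n) f = measure_pmf.expectation (rperm n) g"
  using assms by (intro integral_cong_AE) (auto simp: AE_measure_pmf_iff)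

lemma perms_bounds:
  assumes "\<sigma> \<in> perms n" "w \<in> {1..n}"
  shows "1 \<le> \<sigma> w" "\<sigma> w \<le> n"
  using assms permutes_in_image[of \<sigma> "{1..n}" w] by (auto simp: perms_def)

text \<open>Right translation by \<open>t\<close> is a bijection of the symmetric group and so
  preserves its uniform law. This symmetry stands in for counting permutations below.\<close>

lemma expectation_rperm_comp:
  fixes f :: "(nat \<Rightarrow> nat) \<Rightarrow> real"
  assumes t: "t permutes {1..n}"
  shows "measure_pmf.expectation (rperm n) (\<lambda>\<sigma>. f (\<sigma> \<circ> t)) = measure_pmf.expectation (rperm n) f"
proof -
  have "bij_betw (\<lambda>\<sigma>. \<sigma> \<circ> t) (perms n) (perms n)"
  proof (rule bij_betw_byWitness[where f' = "\<lambda>\<sigma>. \<sigma> \<circ> inv t"])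
    show "\<forall>\<sigma>\<in>perms n. (\<sigma> \<circ> t) \<circ> inv t = \<sigma>"
      using permutes_inv_o(1)[OF t] by (simp add: comp_assoc)
    show "\<forall>\<sigma>\<in>perms n. (\<sigma> \<circ> inv t) \<circ> t = \<sigma>"
      using permutes_inv_o(2)[OF t] by (simp add: comp_assoc)
  qed (use t in \<open>auto simp: perms_def intro!: permutes_compose permutes_inv\<close>)
  hence "map_pmf (\<lambda>\<sigma>. \<sigma> \<circ> t) (rperm n) = rperm n"
    by (intro map_pmf_of_set_bij_betw) auto
  thus ?thesis
    by (metis integral_map_pmf)
qed

lemma sum_perms:
  assumes "\<sigma> \<in> perms n"
  shows "(\<Sum>w\<in>{1..n}. g (\<sigma> w)) = (\<Sum>i\<in>{1..n}. (g i :: real))"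
  using assms sum.permute[of \<sigma> "{1..n}" g] by (simp add: perms_def o_def)

text \<open>By symmetry under transpositions all tokens have the same expectation, and the sum over
  all tokens does not depend on the permutation.\<close>

lemma expectation_rperm_apply:
  fixes g :: "nat \<Rightarrow> real"
  assumes w: "w \<in> {1..n}"
  shows "measure_pmf.expectation (rperm n) (\<lambda>\<sigma>. g (\<sigma> w)) = (\<Sum>i\<in>{1..n}. g i) / n"
proof -
  let ?E = "measure_pmf.expectation (rperm n)"
  have eq: "?E (\<lambda>\<sigma>. g (\<sigma> v)) = ?E (\<lambda>\<sigma>. g (\<sigma> w))" if "v \<in> {1..n}" for v
    using expectation_rperm_comp[OF permutes_swap_id[OF w that], of "\<lambda>\<sigma>. g (\<sigma> w)"] by simp
  have "real n * ?E (\<lambda>\<sigma>. g (\<sigma> w)) = (\<Sum>v\<in>{1..n}. ?E (\<lambda>\<sigma>. g (\<sigma> v)))"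
    by (simp add: eq)
  also have "\<dots> = ?E (\<lambda>\<sigma>. \<Sum>v\<in>{1..n}. g (\<sigma> v))"
    by (subst Bochner_Integration.integral_sum) auto
  also have "\<dots> = ?E (\<lambda>\<sigma>. \<Sum>i\<in>{1..n}. g i)"
    by (intro expectation_rperm_cong sum_perms)
  finally show ?thesis
    using w by (simp add: field_simps)
qed

lemma sum_of_bool_le:
  assumes "j \<le> n"
  shows "(\<Sum>i\<in>{1..n}. of_bool (i \<le> j)) = real j"
proof -
  have "{1..n} \<inter> {i. i \<le> j} = {1..j}"
    using assms by auto
  thus ?thesis
    by (simp add: of_bool_def sum.If_cases)
qed

lemma prob_rperm_le:
  assumes "w \<in> {1..n}" "j \<le> n"
  shows "measure_pmf.expectation (rperm n) (\<lambda>\<sigma>. of_bool (\<sigma> w \<le> j)) = real j / n"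
  using expectation_rperm_apply[OF assms(1), of "\<lambda>i. of_bool (i \<le> j)"] sum_of_bool_le[OF assms(2)]
  by simp

text \<open>Negative correlation in sampling without replacement: the exact value is
  \<open>(j - 1) / (n - 1) * (j / n)\<close>, found by averaging over all partners of
  \<open>w\<close>.\<close>

lemma prob_rperm_le_le:
  assumes w: "w \<in> {1..n}" and v: "v \<in> {1..n}" and wv: "w \<noteq> v" and j: "j \<le> n"
  shows "measure_pmf.expectation (rperm n) (\<lambda>\<sigma>. of_bool (\<sigma> w \<le> j) * of_bool (\<sigma> v \<le> j))
    \<le> (real j / n)\<^sup>2"
proof -
  let ?E = "measure_pmf.expectation (rperm n)"
  let ?X = "\<lambda>\<sigma> v. of_bool (\<sigma> v \<le> j) :: real"
  have n: "n \<ge> 2" using w v wv by auto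
  have eq: "?E (\<lambda>\<sigma>. ?X \<sigma> w * ?X \<sigma> v') = ?E (\<lambda>\<sigma>. ?X \<sigma> w * ?X \<sigma> v)"
    if "v' \<in> {1..n} - {w}" for v'
    using expectation_rperm_comp[OF permutes_swap_id[of v "{1..n}" v'],
        of "\<lambda>\<sigma>. ?X \<sigma> w * ?X \<sigma> v"] that v wv
    by (simp add: Transposition.transpose_def)
  \<comment> \<open>If \<open>w\<close> has rank at most \<open>j\<close>, exactly
    \<open>j - 1\<close> other tokens do too; otherwise both sides vanish. The subtraction is real,
    so \<open>j = 0\<close> does no harm.\<close>
  have *: "(\<Sum>v'\<in>{1..n}-{w}. ?X \<sigma> w * ?X \<sigma> v') = (real j - 1) * ?X \<sigma> w" if "\<sigma> \<in> perms n" for \<sigma>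
  proof -
    have "(\<Sum>v'\<in>{1..n}. ?X \<sigma> v') = real j"
      using sum_perms[OF that, of "\<lambda>i. of_bool (i \<le> j)"] sum_of_bool_le[OF j] by simp
    hence "(\<Sum>v'\<in>{1..n}-{w}. ?X \<sigma> v') = real j - ?X \<sigma> w"
      using w by (subst (asm) sum.remove[of _ w]) auto
    thus ?thesis
      by (auto simp flip: sum_distrib_left)
  qed
  have "(real n - 1) * ?E (\<lambda>\<sigma>. ?X \<sigma> w * ?X \<sigma> v) = (\<Sum>v'\<in>{1..n}-{w}. ?E (\<lambda>\<sigma>. ?X \<sigma> w * ?X \<sigma> v'))"
    using w n by (simp add: eq of_nat_diff)
  also have "\<dots> = ?E (\<lambda>\<sigma>. \<Sum>v'\<in>{1..n}-{w}. ?X \<sigma> w * ?X \<sigma> v')"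
    by (subst Bochner_Integration.integral_sum) auto
  also have "\<dots> = ?E (\<lambda>\<sigma>. (real j - 1) * ?X \<sigma> w)"
    using * by (rule expectation_rperm_cong)
  also have "\<dots> = (real j - 1) * (real j / n)"
    using prob_rperm_le[OF w j] by simp
  finally have "?E (\<lambda>\<sigma>. ?X \<sigma> w * ?X \<sigma> v) = (real j - 1) / (real n - 1) * (real j / n)"
    using n by (simp add: field_simps)
  also have "(real j - 1) / (real n - 1) \<le> real j / n"
    using n j by (simp add: field_simps)
  hence "(real j - 1) / (real n - 1) * (real j / n) \<le> real j / n * (real j / n)"
    by (intro mult_right_mono) auto
  finally show ?thesis
    by (simp add: power2_eq_square)
qed

text \<open>The covariances of distinct indicators are nonpositive, so only the diagonal terms
  contribute to the upper bound, and each indicator has variance at most 1.\<close>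

lemma variance_rperm_mass_le:
  fixes P :: "nat \<Rightarrow> real"
  assumes A: "A \<subseteq> {1..n}" and P: "\<And>w. w \<in> A \<Longrightarrow> 0 \<le> P w" and j: "j \<le> n"
  shows "measure_pmf.expectation (rperm n)
      (\<lambda>\<sigma>. ((\<Sum>w\<in>A. P w * of_bool (\<sigma> w \<le> j)) - (\<Sum>w\<in>A. P w) * (real j / n))\<^sup>2)
    \<le> (\<Sum>w\<in>A. (P w)\<^sup>2)"
proof -
  let ?E = "measure_pmf.expectation (rperm n)"
  let ?X = "\<lambda>\<sigma> w. of_bool (\<sigma> w \<le> j) :: real"
  let ?Z = "\<lambda>\<sigma>. \<Sum>w\<in>A. P w * ?X \<sigma> w"
  define q where "q = (\<Sum>w\<in>A. P w)"
  define a where "a = real j / n"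
  have fin: "finite A" using A finite_subset by blast
  have a: "0 \<le> a" "a \<le> 1" using j by (auto simp: a_def divide_simps)
  have EX: "?E (\<lambda>\<sigma>. ?X \<sigma> w) = a" if "w \<in> A" for w
    using prob_rperm_le[of w n j] that A j by (auto simp: a_def)
  have EZ: "?E ?Z = q * a"
    by (subst Bochner_Integration.integral_sum) (auto simp: EX q_def sum_distrib_right)
  have "?E (\<lambda>\<sigma>. (?Z \<sigma>)\<^sup>2) = (\<Sum>w\<in>A. \<Sum>v\<in>A. P w * P v * ?E (\<lambda>\<sigma>. ?X \<sigma> w * ?X \<sigma> v))"
  proof -
    have "(\<lambda>\<sigma>. (?Z \<sigma>)\<^sup>2) = (\<lambda>\<sigma>. \<Sum>w\<in>A. \<Sum>v\<in>A. P w * P v * (?X \<sigma> w * ?X \<sigma> v))"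
      by (auto simp: power2_eq_square sum_product mult_ac intro!: ext sum.cong)
    thus ?thesis
      by (simp add: Bochner_Integration.integral_sum)
  qed
  \<comment> \<open>The \<open>a\<^sup>2\<close> part will sum to the squared mean; the
    \<open>of_bool\<close> part absorbs the diagonal, where the expectation is \<open>a\<close>, at
    most 1.\<close>
  also have "\<dots> \<le> (\<Sum>w\<in>A. \<Sum>v\<in>A. P w * P v * (a\<^sup>2 + of_bool (w = v)))"
  proof (intro sum_mono mult_left_mono)
    fix w v assume wv: "w \<in> A" "v \<in> A"
    show "?E (\<lambda>\<sigma>. ?X \<sigma> w * ?X \<sigma> v) \<le> a\<^sup>2 + of_bool (w = v)"
    proof (cases "w = v")
      case True
      have "(\<lambda>\<sigma>. ?X \<sigma> w * ?X \<sigma> w) = (\<lambda>\<sigma>. ?X \<sigma> w)" by auto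
      thus ?thesis using True EX[OF wv(1)] a by (simp add: add_increasing)
    next
      case False
      thus ?thesis
        using prob_rperm_le_le[of w n v j] subsetD[OF A] wv j by (simp add: a_def)
    qed
    show "0 \<le> P w * P v" using P wv by auto
  qed
  also have "\<dots> = (q * a)\<^sup>2 + (\<Sum>w\<in>A. (P w)\<^sup>2)"
  proof -
    have "P w * P v * (a\<^sup>2 + of_bool (w = v)) = (P w * a) * (P v * a) + (if v = w then (P w)\<^sup>2 else 0)"
      for w v by (simp add: algebra_simps power2_eq_square)
    moreover have "(q * a)\<^sup>2 = (\<Sum>w\<in>A. \<Sum>v\<in>A. (P w * a) * (P v * a))"
      by (simp only: q_def power2_eq_square sum_distrib_right[of P A a] sum_product)
    ultimately show ?thesis
      using fin by (simp add: sum.distrib)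
  qed
  finally have *: "?E (\<lambda>\<sigma>. (?Z \<sigma>)\<^sup>2) \<le> (q * a)\<^sup>2 + (\<Sum>w\<in>A. (P w)\<^sup>2)" .
  have "?E (\<lambda>\<sigma>. (?Z \<sigma> - q * a)\<^sup>2) = ?E (\<lambda>\<sigma>. (?Z \<sigma>)\<^sup>2) - (q * a)\<^sup>2"
    using measure_pmf.variance_eq[of "rperm n" ?Z] EZ by simp
  with * show ?thesis
    unfolding q_def[symmetric] a_def[symmetric] by linarith
qed

section \<open>Order statistics and the tokens attaining them\<close>

text \<open>Sorting the tokens by probability, rather than the probabilities themselves, keeps track
  of which token is on top. Any other token has index at least 1 in the descending list, even when
  there are ties.\<close>

lemma kth_largest_witness:
  assumes n: "n \<ge> 2"
  obtains t where "t \<in> {1..n}" "P t = kth_largest n P 1"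
    "\<And>w. w \<in> {1..n} \<Longrightarrow> w \<noteq> t \<Longrightarrow> P w \<le> kth_largest n P 2"
proof -
  define xs where "xs = rev (sort_key P [1..<Suc n])"
  have "map P (sort_key P [1..<Suc n]) = sort (map P [1..<Suc n])"
    by (rule properties_for_sort[symmetric]) (auto simp: mset_map simp del: upt_Suc)
  hence map: "map P xs = rev (sort (map P [1..<Suc n]))"
    by (simp add: xs_def flip: rev_map del: upt_Suc)
  have len: "length xs = n" and set: "set xs = {1..n}"
    by (auto simp: xs_def simp del: upt_Suc)
  have "sorted (rev (map P xs))"
    by (simp add: xs_def rev_map del: upt_Suc)
  hence anti: "P (xs ! i) \<le> P (xs ! k)" if "k \<le> i" "i < n" for i k
    using that sorted_rev_nth_mono[of "map P xs" k i] by (simp add: len)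
  have kth: "kth_largest n P i = P (xs ! (i - 1))" if "i - 1 < n" for i
    unfolding kth_largest_def map[symmetric] using that by (simp add: len)
  show ?thesis
  proof (rule that[of "xs ! 0"])
    show "xs ! 0 \<in> {1..n}" using n set len by (metis nth_mem less_le_trans pos2)
    show "P (xs ! 0) = kth_largest n P 1" using kth[of 1] n by simp
    fix w assume w: "w \<in> {1..n}" "w \<noteq> xs ! 0"
    then obtain i where i: "i < n" "xs ! i = w"
      using set len by (metis in_set_conv_nth)
    have "i \<noteq> 0" using i w by metis
    thus "P w \<le> kth_largest n P 2" using anti[of 1 i] kth[of 2] i n by (simp add: One_nat_def)
  qed
qed

section \<open>Inverse transform sampling\<close>

text \<open>For \<open>ntp_dist n P\<close> this is the distribution function of the rank of a token
  drawn from \<open>P\<close>; on the unit interval \<open>inv_cdf\<close> is its quantile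
  function.\<close>

definition rank_mass :: "nat \<Rightarrow> (nat \<Rightarrow> real) \<Rightarrow> (nat \<Rightarrow> nat) \<Rightarrow> nat \<Rightarrow> real" where
  "rank_mass n P \<sigma> j = (\<Sum>w\<in>{1..n}. P w * of_bool (\<sigma> w \<le> j))"

lemma rank_mass_mono:
  assumes "ntp_dist n P" "i \<le> j"
  shows "rank_mass n P \<sigma> i \<le> rank_mass n P \<sigma> j"
  unfolding rank_mass_def using assms
  by (intro sum_mono mult_left_mono) (auto simp: ntp_dist_def)

lemma rank_mass_0:
  assumes "\<sigma> \<in> perms n"
  shows "rank_mass n P \<sigma> 0 = 0"
  unfolding rank_mass_def
proof (rule sum.neutral, rule ballI)
  fix w assume "w \<in> {1..n}"
  from perms_bounds(1)[OF assms this] show "P w * of_bool (\<sigma> w \<le> 0) = 0" by simp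
qed

lemma rank_mass_full:
  assumes "ntp_dist n P" "\<sigma> \<in> perms n" "n \<le> j"
  shows "rank_mass n P \<sigma> j = 1"
proof -
  have "rank_mass n P \<sigma> j = (\<Sum>w\<in>{1..n}. P w)"
    unfolding rank_mass_def using perms_bounds(2)[OF assms(2)] assms(3)
    by (intro sum.cong) (auto intro: order_trans)
  thus ?thesis using assms by (simp add: ntp_dist_def)
qed

text \<open>The second claim is the Galois connection between quantile and distribution function,
  valid for every natural \<open>i\<close>: at \<open>i = 0\<close> both sides fail because
  \<open>0 < u\<close>, and beyond \<open>n\<close> both hold because
  \<open>u \<le> 1\<close>.\<close>

lemma inv_cdf_props:
  assumes P: "ntp_dist n P" and \<sigma>: "\<sigma> \<in> perms n" and n: "n \<ge> 1" and u: "u \<le> 1"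
  shows "inv_cdf n P u \<sigma> \<in> {1..n}"
    and "0 < u \<Longrightarrow> inv_cdf n P u \<sigma> \<le> i \<longleftrightarrow> u \<le> rank_mass n P \<sigma> i"
proof -
  let ?S = "{i \<in> {1..n}. u \<le> rank_mass n P \<sigma> i}"
  have eq: "inv_cdf n P u \<sigma> = Min ?S"
    by (simp add: inv_cdf_def rank_mass_def)
  have S: "finite ?S" "n \<in> ?S"
    using rank_mass_full[OF P \<sigma>, of n] n u by auto
  have in_S: "inv_cdf n P u \<sigma> \<in> ?S"
    unfolding eq using S by (intro Min_in) auto
  thus "inv_cdf n P u \<sigma> \<in> {1..n}" by auto
  assume "0 < u"
  show "inv_cdf n P u \<sigma> \<le> i \<longleftrightarrow> u \<le> rank_mass n P \<sigma> i"
  proof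
    assume "inv_cdf n P u \<sigma> \<le> i"
    thus "u \<le> rank_mass n P \<sigma> i"
      using in_S rank_mass_mono[OF P, of "inv_cdf n P u \<sigma>" i \<sigma>] by simp
  next
    assume *: "u \<le> rank_mass n P \<sigma> i"
    show "inv_cdf n P u \<sigma> \<le> i"
    proof (cases "i \<le> n")
      case True
      have "i \<noteq> 0" using * \<open>0 < u\<close> rank_mass_0[OF \<sigma>, of P] by (intro notI) auto
      hence "i \<in> ?S" using True * by auto
      thus ?thesis unfolding eq using S by (intro Min_le) auto
    next
      case False
      thus ?thesis using in_S by auto
    qed
  qed
qed

text \<open>Writing the minimum as \<open>LEAST\<close> lets measurability be derived automatically.
  For \<open>u > 1\<close> the set is empty and the value is the constant
  \<open>Min {}\<close>.\<close>

lemma measurable_inv_cdf [measurable]: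
  assumes P: "ntp_dist n P" and \<sigma>: "\<sigma> \<in> perms n" and n: "n \<ge> 1"
  shows "(\<lambda>u. inv_cdf n P u \<sigma>) \<in> borel \<rightarrow>\<^sub>M count_space UNIV"
proof -
  have "inv_cdf n P u \<sigma> = (if u \<le> 1 then LEAST i. i \<in> {1..n} \<and> u \<le> rank_mass n P \<sigma> i
      else Min {})" for u
  proof (cases "u \<le> 1")
    case True
    have "n \<in> {i \<in> {1..n}. u \<le> rank_mass n P \<sigma> i}"
      using rank_mass_full[OF P \<sigma>, of n] n True by auto
    thus ?thesis
      using True by (subst Least_Min) (auto simp: inv_cdf_def rank_mass_def)
  next
    case False
    have "rank_mass n P \<sigma> i \<le> 1" for i
      using rank_mass_mono[OF P, of i "max i n" \<sigma>] rank_mass_full[OF P \<sigma>, of "max i n"] by simp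
    hence "{i \<in> {1..n}. u \<le> rank_mass n P \<sigma> i} = {}"
      using False by (auto simp: not_le intro: le_less_trans)
    thus ?thesis
      using False by (simp only: inv_cdf_def rank_mass_def[symmetric] if_False)
  qed
  thus ?thesis by simp
qed

text \<open>The largest rank \<open>i\<close> with \<open>eta n i \<le> u + r\<close>, capped at
  \<open>n\<close> so that \<open>hi_rank n r u / n\<close> is a probability.\<close>

definition hi_rank :: "nat \<Rightarrow> real \<Rightarrow> real \<Rightarrow> nat" where
  "hi_rank n r u = min n (nat \<lfloor>(u + r) * (real n - 1) + 1\<rfloor>)"

text \<open>The largest rank \<open>i\<close> with \<open>eta n i < u - r\<close>, whence ceiling
  minus one. Negative values become 0, where \<open>rank_mass\<close> vanishes.\<close>

definition lo_rank :: "nat \<Rightarrow> real \<Rightarrow> real \<Rightarrow> nat" where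
  "lo_rank n r u = nat (\<lceil>(u - r) * (real n - 1) + 1\<rceil> - 1)"

text \<open>The first inequality nests the two threshold events, so that the probability of their
  difference is a difference of probabilities; the second makes the tail estimates applicable at
  \<open>lo_rank\<close>.\<close>

lemma lo_rank_le_hi_rank:
  assumes n: "n \<ge> 2" and r: "0 \<le> r" and u: "u < 1"
  shows "lo_rank n r u \<le> hi_rank n r u" "lo_rank n r u \<le> n"
proof -
  define x y where "x = (u - r) * (real n - 1) + 1" and "y = (u + r) * (real n - 1) + 1"
  have "x \<le> y" unfolding x_def y_def using n r by (intro add_mono mult_right_mono) auto
  hence "\<lceil>x\<rceil> - 1 \<le> \<lfloor>y\<rfloor>" by linarith
  moreover have "(u - r) * (real n - 1) \<le> 1 * (real n - 1)"
    using n r u by (intro mult_right_mono) auto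
  hence "x \<le> real n" by (simp add: x_def)
  hence "\<lceil>x\<rceil> - 1 \<le> int n" by linarith
  ultimately show "lo_rank n r u \<le> hi_rank n r u" "lo_rank n r u \<le> n"
    unfolding lo_rank_def hi_rank_def x_def[symmetric] y_def[symmetric] by auto
qed

text \<open>The rank of the watermarked token is \<open>inv_cdf\<close> itself. Solving the
  inequality for this rank gives an integer window, which the Galois connection turns into
  conditions on \<open>u\<close>.\<close>

lemma Y_dif_watermark_le_iff:
  assumes P: "ntp_dist n P" and \<sigma>: "\<sigma> \<in> perms n" and n: "n \<ge> 2" and u: "0 < u" "u < 1"
  shows "Y_dif n u \<sigma> (watermark_token n P u \<sigma>) \<le> r \<longleftrightarrow>
    u \<le> rank_mass n P \<sigma> (hi_rank n r u) \<and> \<not> u \<le> rank_mass n P \<sigma> (lo_rank n r u)"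
proof -
  have n1: "0 < real n - 1" using n by simp
  define I where "I = inv_cdf n P u \<sigma>"
  have I: "I \<in> {1..n}" and le: "\<And>i. u \<le> rank_mass n P \<sigma> i \<longleftrightarrow> I \<le> i"
    unfolding I_def using inv_cdf_props[OF P \<sigma>, of u] n u by auto
  have "\<sigma> (inv \<sigma> I) = I"
    using \<sigma> by (simp add: perms_def permutes_inverses)
  hence "Y_dif n u \<sigma> (watermark_token n P u \<sigma>) \<le> r \<longleftrightarrow>
      (real I - 1) / (real n - 1) \<le> u + r \<and> u - r \<le> (real I - 1) / (real n - 1)"
    by (auto simp: Y_dif_def watermark_token_def I_def[symmetric] eta_def abs_le_iff)
  also have "(real I - 1) / (real n - 1) \<le> u + r \<longleftrightarrow> real I \<le> (u + r) * (real n - 1) + 1"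
    by (subst pos_divide_le_eq[OF n1]) linarith
  also have "\<dots> \<longleftrightarrow> I \<le> hi_rank n r u"
  proof -
    \<comment> \<open>Truncation by \<open>nat\<close> is harmless because \<open>I\<close> is at
      least 1.\<close>
    have le_nat: "I \<le> nat k \<longleftrightarrow> int I \<le> k" for k using I by auto
    show ?thesis
      using I unfolding hi_rank_def min.bounded_iff le_nat le_floor_iff by simp
  qed
  also have "u - r \<le> (real I - 1) / (real n - 1) \<longleftrightarrow> (u - r) * (real n - 1) + 1 \<le> real I"
    by (subst pos_le_divide_eq[OF n1]) linarith
  also have "\<dots> \<longleftrightarrow> \<not> I \<le> lo_rank n r u"
  proof -
    have le_nat: "I \<le> nat k \<longleftrightarrow> int I \<le> k" for k using I by auto
    have "int I \<le> \<lceil>x\<rceil> - 1 \<longleftrightarrow> \<not> x \<le> real I" for x :: real by linarith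
    thus ?thesis unfolding lo_rank_def le_nat by blast
  qed
  finally show ?thesis by (simp add: le)
qed

section \<open>The law of the statistic\<close>

abbreviation unif :: "real measure" where
  "unif \<equiv> uniform_measure lborel {0<..<1}"

lemma prob_space_unif: "prob_space unif"
  by (rule prob_space_uniform_measure) auto

lemma measurable_Y_dif_watermark [measurable]:
  assumes "ntp_dist n P" "\<sigma> \<in> perms n" "n \<ge> 1"
  shows "(\<lambda>u. Y_dif n u \<sigma> (watermark_token n P u \<sigma>)) \<in> borel_measurable borel"
proof -
  note measurable_inv_cdf[OF assms, measurable]
  show ?thesis
    unfolding Y_dif_def watermark_token_def by measurable
qed

text \<open>The event splits according to the finitely many values of \<open>\<pi>\<close>.
  Independence makes the probability of each piece a product, and uniformity of \<open>\<pi>\<close>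
  makes the sum an average.\<close>

lemma pseudorandom_disintegration:
  assumes ps: "pseudorandom n M U \<pi>" and B: "\<And>\<sigma>. \<sigma> \<in> perms n \<Longrightarrow> B \<sigma> \<in> sets borel"
  shows "{\<omega> \<in> space M. U \<omega> \<in> B (\<pi> \<omega>)} \<in> sets M"
    and "measure M {\<omega> \<in> space M. U \<omega> \<in> B (\<pi> \<omega>)} =
      measure_pmf.expectation (rperm n) (\<lambda>\<sigma>. measure unif (B \<sigma>))"
proof -
  interpret prob_space M using ps by (simp add: pseudorandom_def)
  have U [measurable]: "U \<in> borel_measurable M"
    and \<pi> [measurable]: "\<pi> \<in> measurable M (count_space (perms n))"
    and dU: "distr M borel U = unif"
    and d\<pi>: "distr M (count_space (perms n)) \<pi> = uniform_count_measure (perms n)"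
    and ind: "indep_set {U -` A \<inter> space M | A. A \<in> sets borel}
      {\<pi> -` B \<inter> space M | B. B \<in> sets (count_space (perms n))}"
    using ps by (auto simp: pseudorandom_def indep_rv_def)
  define E where "E \<sigma> = (U -` B \<sigma> \<inter> space M) \<inter> (\<pi> -` {\<sigma>} \<inter> space M)" for \<sigma>
  have E: "E \<sigma> \<in> sets M" if "\<sigma> \<in> perms n" for \<sigma>
    unfolding E_def using B[OF that] that by (intro sets.Int measurable_sets[OF U] measurable_sets[OF \<pi>]) auto
  have \<pi>_in: "\<pi> \<omega> \<in> perms n" if "\<omega> \<in> space M" for \<omega>
    using measurable_space[OF \<pi> that] by simp
  have eq: "{\<omega> \<in> space M. U \<omega> \<in> B (\<pi> \<omega>)} = (\<Union>\<sigma>\<in>perms n. E \<sigma>)"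
    using \<pi>_in by (auto simp: E_def)
  show "{\<omega> \<in> space M. U \<omega> \<in> B (\<pi> \<omega>)} \<in> sets M"
    unfolding eq using E by (intro sets.finite_UN) auto
  have "prob (E \<sigma>) = measure unif (B \<sigma>) / card (perms n)" if \<sigma>: "\<sigma> \<in> perms n" for \<sigma>
  proof -
    have "prob (E \<sigma>) = prob (U -` B \<sigma> \<inter> space M) * prob (\<pi> -` {\<sigma>} \<inter> space M)"
      unfolding E_def using B[OF \<sigma>] \<sigma> by (intro indep_setD[OF ind]) auto
    also have "prob (U -` B \<sigma> \<inter> space M) = measure unif (B \<sigma>)"
      unfolding dU[symmetric] using B[OF \<sigma>] by (intro measure_distr[symmetric]) auto
    also have "prob (\<pi> -` {\<sigma>} \<inter> space M) = measure (uniform_count_measure (perms n)) {\<sigma>}"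
      unfolding d\<pi>[symmetric] using \<sigma> by (intro measure_distr[symmetric]) auto
    also have "\<dots> = 1 / card (perms n)"
      using \<sigma> by (subst measure_uniform_count_measure) auto
    finally show ?thesis by simp
  qed
  moreover have "prob (\<Union>\<sigma>\<in>perms n. E \<sigma>) = (\<Sum>\<sigma>\<in>perms n. prob (E \<sigma>))"
    using E by (intro finite_measure_finite_Union) (auto simp: disjoint_family_on_def E_def)
  ultimately show "measure M {\<omega> \<in> space M. U \<omega> \<in> B (\<pi> \<omega>)} =
      measure_pmf.expectation (rperm n) (\<lambda>\<sigma>. measure unif (B \<sigma>))"
    unfolding eq by (simp add: integral_pmf_of_set sum_divide_distrib)
qed

text \<open>The watermark law without the underlying space \<open>M\<close>, so that limits involve
  only \<open>n\<close> and \<open>P\<close>.\<close>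

definition wm_cdf :: "nat \<Rightarrow> (nat \<Rightarrow> real) \<Rightarrow> real \<Rightarrow> real" where
  "wm_cdf n P r = measure_pmf.expectation (rperm n)
     (\<lambda>\<sigma>. measure unif {u. Y_dif n u \<sigma> (watermark_token n P u \<sigma>) \<le> r})"

lemma cdf_Y_dif_H1:
  assumes P: "ntp_dist n P" and n: "n \<ge> 1" and H1: "model_H1 n P M U \<pi> w"
  shows "cdf_Y_dif n M U \<pi> w r = wm_cdf n P r"
proof -
  have ps: "pseudorandom n M U \<pi>" using H1 by (simp add: model_H1_def)
  have "cdf_Y_dif n M U \<pi> w r = measure M {\<omega> \<in> space M.
      U \<omega> \<in> {u. Y_dif n u (\<pi> \<omega>) (watermark_token n P u (\<pi> \<omega>)) \<le> r}}"
    using H1 unfolding cdf_Y_dif_def model_H1_def by (intro arg_cong[where f = "measure M"]) auto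
  also have "\<dots> = wm_cdf n P r"
    unfolding wm_cdf_def
  proof (rule pseudorandom_disintegration(2)[OF ps])
    fix \<sigma> assume "\<sigma> \<in> perms n"
    note [measurable] = measurable_Y_dif_watermark[OF P this n]
    show "{u. Y_dif n u \<sigma> (watermark_token n P u \<sigma>) \<le> r} \<in> sets borel"
      by measurable
  qed
  finally show ?thesis .
qed

text \<open>The function \<open>rank_mass\<close> jumps from 0 to 1 at the rank of \<open>v\<close>,
  so this rank is the quantile for every \<open>u\<close> in the range.\<close>

lemma watermark_token_point_mass:
  assumes \<sigma>: "\<sigma> \<in> perms n" and v: "v \<in> {1..n}" and u: "0 < u" "u \<le> 1"
  shows "watermark_token n (\<lambda>w. of_bool (w = v)) u \<sigma> = v"
proof -
  let ?P = "\<lambda>w. of_bool (w = v) :: real"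
  have "rank_mass n ?P \<sigma> i = of_bool (\<sigma> v \<le> i)" for i
  proof -
    have "rank_mass n ?P \<sigma> i = (\<Sum>w\<in>{1..n}. if w = v then of_bool (\<sigma> v \<le> i) else 0)"
      unfolding rank_mass_def by (intro sum.cong) auto
    thus ?thesis using v by simp
  qed
  hence "inv_cdf n ?P u \<sigma> = Min {i \<in> {1..n}. \<sigma> v \<le> i}"
    using u unfolding inv_cdf_def rank_mass_def[symmetric] by (intro arg_cong[where f = Min]) auto
  also have "\<dots> = \<sigma> v"
    using perms_bounds[OF \<sigma> v] by (intro Min_eqI) auto
  finally show ?thesis
    using \<sigma> by (simp add: watermark_token_def perms_def permutes_inverses)
qed

lemma ntp_dist_point_mass:
  assumes "v \<in> {1..n}"
  shows "ntp_dist n (\<lambda>w. of_bool (w = v))"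
  using assms by (simp add: ntp_dist_def of_bool_def)

text \<open>A point mass makes the watermarked token deterministic; which token it is does not matter,
  because the rank of any fixed token is uniform.\<close>

lemma cdf_Y_dif_H0:
  assumes n: "n \<ge> 1" and H0: "model_H0 n M U \<pi> w"
  shows "cdf_Y_dif n M U \<pi> w r = wm_cdf n (\<lambda>v. of_bool (v = 1)) r"
proof -
  have ps: "pseudorandom n M U \<pi>" using H0 by (simp add: model_H0_def)
  interpret prob_space M using ps by (simp add: pseudorandom_def)
  let ?T = "borel \<Otimes>\<^sub>M count_space (perms n)"
  have w [measurable]: "w \<in> measurable M (count_space {1..n})"
    and U\<pi>: "(\<lambda>\<omega>. (U \<omega>, \<pi> \<omega>)) \<in> measurable M ?T"
    and ind: "indep_set {w -` A \<inter> space M | A. A \<in> sets (count_space {1..n})}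
      {(\<lambda>\<omega>. (U \<omega>, \<pi> \<omega>)) -` B \<inter> space M | B. B \<in> sets ?T}"
    using H0 by (auto simp: model_H0_def indep_rv_def)
  define B where "B i = {u. \<bar>u - eta n i\<bar> \<le> r}" for i
  have B [measurable]: "B i \<in> sets borel" for i
    unfolding B_def by measurable
  \<comment> \<open>The common probability of \<open>E v\<close>: the rank of a fixed token is
    uniform, so \<open>c\<close> does not involve \<open>v\<close>.\<close>
  define c where "c = (\<Sum>i\<in>{1..n}. measure unif (B i)) / n"
  define E where "E v = {\<omega> \<in> space M. U \<omega> \<in> B (\<pi> \<omega> v)}" for v
  have E: "E v \<in> sets M" "prob (E v) = c" if "v \<in> {1..n}" for v
  proof -
    show "E v \<in> sets M"
      unfolding E_def using pseudorandom_disintegration(1)[OF ps, of "\<lambda>\<sigma>. B (\<sigma> v)"] B by simp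
    have "prob (E v) = measure_pmf.expectation (rperm n) (\<lambda>\<sigma>. measure unif (B (\<sigma> v)))"
      unfolding E_def using pseudorandom_disintegration(2)[OF ps, of "\<lambda>\<sigma>. B (\<sigma> v)"] B by simp
    thus "prob (E v) = c"
      using expectation_rperm_apply[OF that, of "\<lambda>i. measure unif (B i)"] by (simp add: c_def)
  qed
  have prod: "prob ((w -` {v} \<inter> space M) \<inter> E v) = prob (w -` {v} \<inter> space M) * c"
    if v: "v \<in> {1..n}" for v
  proof -
    \<comment> \<open>Independence is assumed from the pair \<open>(U, \<pi>)\<close>, so
      \<open>E v\<close> has to be exhibited as the preimage of a measurable set of pairs.\<close>
    let ?C = "\<Union>\<sigma>\<in>perms n. B (\<sigma> v) \<times> {\<sigma>}"
    have "?C \<in> sets ?T"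
      by (intro sets.finite_UN pair_measureI) auto
    moreover have "E v = (\<lambda>\<omega>. (U \<omega>, \<pi> \<omega>)) -` ?C \<inter> space M"
      using measurable_space[OF U\<pi>] by (auto simp: E_def space_pair_measure)
    ultimately have "prob ((w -` {v} \<inter> space M) \<inter> E v) = prob (w -` {v} \<inter> space M) * prob (E v)"
      using v by (intro indep_setD[OF ind]) (auto intro!: exI[of _ "{v}"])
    thus ?thesis using E(2)[OF v] by simp
  qed
  have W: "w -` {v} \<inter> space M \<in> sets M" if "v \<in> {1..n}" for v
    using that by (intro measurable_sets[OF w]) auto
  have w_in: "w \<omega> \<in> {1..n}" if "\<omega> \<in> space M" for \<omega>
    using measurable_space[OF w that] by simp
  \<comment> \<open>Partition by the token; every piece carries the same factor \<open>c\<close>,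
    and the token probabilities sum to 1.\<close>
  have "{\<omega> \<in> space M. Y_dif n (U \<omega>) (\<pi> \<omega>) (w \<omega>) \<le> r}
      = (\<Union>v\<in>{1..n}. (w -` {v} \<inter> space M) \<inter> E v)"
    using w_in by (auto simp: E_def B_def Y_dif_def)
  hence "cdf_Y_dif n M U \<pi> w r = (\<Sum>v\<in>{1..n}. prob ((w -` {v} \<inter> space M) \<inter> E v))"
    unfolding cdf_Y_dif_def using E W
    by (simp only:) (intro finite_measure_finite_Union, auto simp: disjoint_family_on_def)
  also have "\<dots> = (\<Sum>v\<in>{1..n}. prob (w -` {v} \<inter> space M)) * c"
    by (simp add: prod sum_distrib_right)
  also have "(\<Sum>v\<in>{1..n}. prob (w -` {v} \<inter> space M)) = prob (\<Union>v\<in>{1..n}. w -` {v} \<inter> space M)"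
    using W by (intro finite_measure_finite_Union[symmetric]) (auto simp: disjoint_family_on_def)
  also have "(\<Union>v\<in>{1..n}. w -` {v} \<inter> space M) = space M"
    using w_in by auto
  finally have *: "cdf_Y_dif n M U \<pi> w r = c"
    by (simp add: prob_space)
  let ?P = "\<lambda>v. of_bool (v = (1::nat)) :: real"
  have one: "1 \<in> {1..n}" using n by simp
  have "wm_cdf n ?P r = measure_pmf.expectation (rperm n) (\<lambda>\<sigma>. measure unif (B (\<sigma> 1)))"
    unfolding wm_cdf_def
  proof (rule expectation_rperm_cong)
    fix \<sigma> assume \<sigma>: "\<sigma> \<in> perms n"
    note [measurable] = measurable_Y_dif_watermark[OF ntp_dist_point_mass[OF one] \<sigma> n]
    show "measure unif {u. Y_dif n u \<sigma> (watermark_token n ?P u \<sigma>) \<le> r} = measure unif (B (\<sigma> 1))"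
    proof (rule measure_eq_AE)
      \<comment> \<open>The sets are compared only inside the unit interval, where the token is
        known to be 1.\<close>
      have "AE u in lborel. u \<in> {0<..<1} \<longrightarrow> u \<in> {u. Y_dif n u \<sigma> (watermark_token n ?P u \<sigma>) \<le> r} \<longleftrightarrow> u \<in> B (\<sigma> 1)"
        using watermark_token_point_mass[OF \<sigma> one] by (auto simp: B_def Y_dif_def)
      thus "AE u in unif. u \<in> {u. Y_dif n u \<sigma> (watermark_token n ?P u \<sigma>) \<le> r} \<longleftrightarrow> u \<in> B (\<sigma> 1)"
        by (intro AE_uniform_measureI) auto
    qed (simp_all, measurable)
  qed
  also have "\<dots> = c"
    using expectation_rperm_apply[OF one, of "\<lambda>i. measure unif (B i)"] by (simp add: c_def)
  finally show ?thesis using * by simp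
qed

section \<open>The limit law\<close>

text \<open>Away from the atoms this is the probability that
  \<open>\<Delta> * a + (1 - \<Delta>) * X\<close> exceeds \<open>u\<close>, with \<open>X\<close> a
  Bernoulli variable of parameter \<open>a\<close>.\<close>

definition limit_tail :: "real \<Rightarrow> real \<Rightarrow> real \<Rightarrow> real" where
  "limit_tail \<Delta> a u = (if u < \<Delta> * a then 1 else if u < \<Delta> * a + (1 - \<Delta>) then a else 0)"

abbreviation tail_prob :: "nat \<Rightarrow> (nat \<Rightarrow> real) \<Rightarrow> real \<Rightarrow> nat \<Rightarrow> real" where
  "tail_prob n P u j \<equiv> measure_pmf.expectation (rperm n) (\<lambda>\<sigma>. of_bool (u \<le> rank_mass n P \<sigma> j))"

text \<open>The mass ranked at most \<open>j\<close> is \<open>P t\<close> times an indicator, plus the contribution \<open>Z\<close> of the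
  other tokens, which Chebyshev's inequality concentrates at its mean.\<close>

lemma tail_prob_approx:
  fixes \<Delta> a u \<epsilon> b :: real
  assumes P: "ntp_dist n P" and t: "t \<in> {1..n}" and j: "j \<le> n" and \<epsilon>: "\<epsilon> > 0"
    and others: "\<And>w. w \<in> {1..n} \<Longrightarrow> w \<noteq> t \<Longrightarrow> P w \<le> b" and b: "0 \<le> b"
    and m: "\<bar>(1 - P t) * (real j / n) - \<Delta> * a\<bar> < \<epsilon>" and p: "\<bar>P t - (1 - \<Delta>)\<bar> < \<epsilon>"
    and u: "3 * \<epsilon> \<le> \<bar>u - \<Delta> * a\<bar>" "3 * \<epsilon> \<le> \<bar>u - (\<Delta> * a + (1 - \<Delta>))\<bar>"
  shows "\<bar>tail_prob n P u j -
      (if u < \<Delta> * a then 1 else if u < \<Delta> * a + (1 - \<Delta>) then real j / n else 0)\<bar> \<le> b / \<epsilon>\<^sup>2"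
proof -
  let ?E = "measure_pmf.expectation (rperm n)"
  define A where "A = {1..n} - {t}"
  define Z where "Z \<sigma> = (\<Sum>w\<in>A. P w * of_bool (\<sigma> w \<le> j))" for \<sigma>
  define \<mu> where "\<mu> = (1 - P t) * (real j / n)"
  \<comment> \<open>The limiting event: \<open>Z\<close> is replaced by \<open>\<Delta> * a\<close>
    and \<open>P t\<close> by \<open>1 - \<Delta>\<close>.\<close>
  define T where "T \<sigma> = (u < \<Delta> * a \<or> u < \<Delta> * a + (1 - \<Delta>) \<and> \<sigma> t \<le> j)" for \<sigma> :: "nat \<Rightarrow> nat"
  have P0: "0 \<le> P w" if "w \<in> {1..n}" for w
    using P that by (simp add: ntp_dist_def)
  have sumA: "(\<Sum>w\<in>A. P w) = 1 - P t"
    using P t by (simp add: ntp_dist_def A_def sum_diff1)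
  have split: "rank_mass n P \<sigma> j = P t * of_bool (\<sigma> t \<le> j) + Z \<sigma>" for \<sigma>
    unfolding rank_mass_def Z_def A_def using t by (intro sum.remove) auto
  have "?E (\<lambda>\<sigma>. (Z \<sigma> - \<mu>)\<^sup>2) \<le> (\<Sum>w\<in>A. (P w)\<^sup>2)"
    unfolding Z_def \<mu>_def sumA[symmetric]
    by (rule variance_rperm_mass_le) (use P0 j in \<open>auto simp: A_def\<close>)
  also have "\<dots> \<le> (\<Sum>w\<in>A. b * P w)"
    unfolding power2_eq_square using P0 others by (intro sum_mono mult_right_mono) (auto simp: A_def)
  also have "\<dots> = b * (1 - P t)"
    by (simp add: sumA flip: sum_distrib_left)
  also have "\<dots> \<le> b"
    using b P0[OF t] by (simp add: mult_left_le)
  finally have var: "?E (\<lambda>\<sigma>. (Z \<sigma> - \<mu>)\<^sup>2) \<le> b" .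
  \<comment> \<open>Where \<open>Z\<close> is within \<open>\<epsilon>\<close> of its mean, the
    errors in \<open>Z\<close> (below \<open>2 * \<epsilon>\<close>) and in \<open>P t\<close>
    (below \<open>\<epsilon>\<close>) stay within the margin \<open>3 * \<epsilon>\<close>, so the
    events agree. Elsewhere the right-hand side is at least 1.\<close>
  have pointwise: "\<bar>of_bool (u \<le> rank_mass n P \<sigma> j) - of_bool (T \<sigma>)\<bar> \<le> (Z \<sigma> - \<mu>)\<^sup>2 / \<epsilon>\<^sup>2" for \<sigma>
  proof (cases "\<bar>Z \<sigma> - \<mu>\<bar> < \<epsilon>")
    case True
    hence Z: "\<bar>Z \<sigma> - \<Delta> * a\<bar> < 2 * \<epsilon>" using m unfolding \<mu>_def by linarith
    have "u \<le> rank_mass n P \<sigma> j \<longleftrightarrow> T \<sigma>"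
      using Z p u P0[OF t] \<epsilon> unfolding split T_def by (cases "\<sigma> t \<le> j") (simp_all, linarith+)
    thus ?thesis by simp
  next
    case False
    hence "\<epsilon>\<^sup>2 \<le> \<bar>Z \<sigma> - \<mu>\<bar>\<^sup>2" using \<epsilon> by (intro power_mono) auto
    hence "1 \<le> (Z \<sigma> - \<mu>)\<^sup>2 / \<epsilon>\<^sup>2" using \<epsilon> by simp
    moreover have "\<bar>of_bool (u \<le> rank_mass n P \<sigma> j) - of_bool (T \<sigma>) :: real\<bar> \<le> 1" by simp
    ultimately show ?thesis by linarith
  qed
  have ET: "?E (\<lambda>\<sigma>. of_bool (T \<sigma>)) =
      (if u < \<Delta> * a then 1 else if u < \<Delta> * a + (1 - \<Delta>) then real j / n else 0)"
    using prob_rperm_le[OF t j] by (simp add: T_def)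
  have "\<bar>tail_prob n P u j - ?E (\<lambda>\<sigma>. of_bool (T \<sigma>))\<bar>
      = \<bar>?E (\<lambda>\<sigma>. of_bool (u \<le> rank_mass n P \<sigma> j) - of_bool (T \<sigma>))\<bar>"
    by (subst Bochner_Integration.integral_diff) auto
  also have "\<dots> \<le> ?E (\<lambda>\<sigma>. \<bar>of_bool (u \<le> rank_mass n P \<sigma> j) - of_bool (T \<sigma>)\<bar>)"
    by (rule integral_abs_bound)
  also have "\<dots> \<le> ?E (\<lambda>\<sigma>. (Z \<sigma> - \<mu>)\<^sup>2 / \<epsilon>\<^sup>2)"
    using pointwise by (intro integral_mono) auto
  also have "\<dots> = ?E (\<lambda>\<sigma>. (Z \<sigma> - \<mu>)\<^sup>2) / \<epsilon>\<^sup>2"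
    by simp
  also have "\<dots> \<le> b / \<epsilon>\<^sup>2"
    using var by (intro divide_right_mono) auto
  finally show ?thesis by (simp add: ET)
qed

text \<open>For fixed \<open>u\<close> off the two jumps the margin \<open>\<epsilon>\<close> can be
  kept fixed, so the Chebyshev error vanishes with the second largest probability.\<close>

lemma tail_prob_tendsto:
  fixes \<Delta> a u :: real
  assumes P: "\<And>n. n \<ge> 2 \<Longrightarrow> ntp_dist n (P n)"
    and top: "(\<lambda>n. kth_largest n (P n) 1) \<longlonglongrightarrow> 1 - \<Delta>"
    and second: "(\<lambda>n. kth_largest n (P n) 2) \<longlonglongrightarrow> 0"
    and j: "\<And>n. n \<ge> 2 \<Longrightarrow> j n \<le> n" and ja: "(\<lambda>n. real (j n) / n) \<longlonglongrightarrow> a"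
    and u: "u \<noteq> \<Delta> * a" "u \<noteq> \<Delta> * a + (1 - \<Delta>)"
  shows "(\<lambda>n. tail_prob n (P n) u (j n)) \<longlonglongrightarrow> limit_tail \<Delta> a u"
proof -
  \<comment> \<open>A third of the distance from \<open>u\<close> to the nearer jump of the
    limit.\<close>
  define \<epsilon> where "\<epsilon> = min \<bar>u - \<Delta> * a\<bar> \<bar>u - (\<Delta> * a + (1 - \<Delta>))\<bar> / 3"
  have \<epsilon>: "\<epsilon> > 0" using u by (simp add: \<epsilon>_def)
  define p b where "p n = kth_largest n (P n) 1" and "b n = kth_largest n (P n) 2" for n
  define v where "v n = (if u < \<Delta> * a then 1
      else if u < \<Delta> * a + (1 - \<Delta>) then real (j n) / n else 0)" for n
  have "(\<lambda>n. (1 - p n) * (real (j n) / n)) \<longlonglongrightarrow> (1 - (1 - \<Delta>)) * a"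
    unfolding p_def by (intro tendsto_intros top ja)
  hence "eventually (\<lambda>n. dist ((1 - p n) * (real (j n) / n)) ((1 - (1 - \<Delta>)) * a) < \<epsilon>) sequentially"
    using \<epsilon> by (rule tendstoD)
  moreover have "eventually (\<lambda>n. dist (p n) (1 - \<Delta>) < \<epsilon>) sequentially"
    unfolding p_def using top \<epsilon> by (rule tendstoD)
  ultimately have "eventually (\<lambda>n. norm (tail_prob n (P n) u (j n) - v n) \<le> b n / \<epsilon>\<^sup>2) sequentially"
    using eventually_ge_at_top[of 2]
  proof eventually_elim
    case (elim n)
    from kth_largest_witness[OF elim(3), of "P n"] obtain t where t: "t \<in> {1..n}"
      "P n t = p n" "\<And>w. w \<in> {1..n} \<Longrightarrow> w \<noteq> t \<Longrightarrow> P n w \<le> b n"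
      unfolding p_def b_def by metis
    \<comment> \<open>Some token other than \<open>t\<close>; its nonnegative probability shows that
      the bound \<open>b n\<close> is nonnegative.\<close>
    define w :: nat where "w = (if t = 1 then 2 else 1)"
    have "w \<in> {1..n}" "w \<noteq> t" using elim(3) by (auto simp: w_def)
    moreover from this have "0 \<le> P n w" using P[OF elim(3)] by (simp add: ntp_dist_def)
    ultimately have b: "0 \<le> b n" using t(3) order_trans by blast
    have "\<bar>tail_prob n (P n) u (j n) - v n\<bar> \<le> b n / \<epsilon>\<^sup>2"
      unfolding v_def
      by (rule tail_prob_approx[OF P[OF elim(3)] t(1) j[OF elim(3)] \<epsilon> t(3) b])
         (use elim t(2) in \<open>auto simp: dist_real_def \<epsilon>_def\<close>)
    thus ?case by simp
  qed
  moreover have "(\<lambda>n. b n / \<epsilon>\<^sup>2) \<longlonglongrightarrow> 0 / \<epsilon>\<^sup>2"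
    unfolding b_def using \<epsilon> by (intro tendsto_intros second) auto
  hence "(\<lambda>n. b n / \<epsilon>\<^sup>2) \<longlonglongrightarrow> 0" by simp
  ultimately have "(\<lambda>n. tail_prob n (P n) u (j n) - v n) \<longlonglongrightarrow> 0"
    by (rule Lim_null_comparison)
  moreover have "v \<longlonglongrightarrow> limit_tail \<Delta> a u"
    unfolding v_def limit_tail_def using ja by auto
  ultimately have "(\<lambda>n. tail_prob n (P n) u (j n) - v n + v n) \<longlonglongrightarrow> 0 + limit_tail \<Delta> a u"
    by (rule tendsto_add)
  thus ?thesis by simp
qed

section \<open>Asymptotics of the threshold ranks\<close>

lemma hi_rank_tendsto:
  assumes "0 \<le> u + r"
  shows "(\<lambda>n. real (hi_rank n r u) / n) \<longlonglongrightarrow> min 1 (u + r)"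
proof -
  define y where "y n = (u + r) * (real n - 1) + 1" for n
  have "(\<lambda>n. of_int \<lfloor>y n\<rfloor> / real n) \<longlonglongrightarrow> u + r"
  proof (rule tendsto_sandwich)
    show "(\<lambda>n. (y n - 1) / real n) \<longlonglongrightarrow> u + r" "(\<lambda>n. y n / real n) \<longlonglongrightarrow> u + r"
      unfolding y_def by real_asymp+
    show "eventually (\<lambda>n. (y n - 1) / real n \<le> of_int \<lfloor>y n\<rfloor> / real n) sequentially"
      by (intro always_eventually allI divide_right_mono) linarith+
    show "eventually (\<lambda>n. of_int \<lfloor>y n\<rfloor> / real n \<le> y n / real n) sequentially"
      by (intro always_eventually allI divide_right_mono) linarith+
  qed
  hence "(\<lambda>n. min 1 (of_int \<lfloor>y n\<rfloor> / real n)) \<longlonglongrightarrow> min 1 (u + r)"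
    by (intro tendsto_min tendsto_const)
  moreover have "eventually (\<lambda>n. min 1 (of_int \<lfloor>y n\<rfloor> / real n) = real (hi_rank n r u) / n) sequentially"
    using eventually_ge_at_top[of 1]
  proof eventually_elim
    case (elim n)
    \<comment> \<open>So \<open>nat\<close> does not truncate, and only the cap at \<open>n\<close>
      shows in the limit, as \<open>min 1\<close>.\<close>
    have "0 \<le> y n" using assms elim by (simp add: y_def)
    thus ?case using elim
      by (simp add: hi_rank_def y_def[symmetric] of_nat_min min_divide_distrib_right)
  qed
  ultimately show ?thesis by (rule Lim_transform_eventually)
qed

lemma lo_rank_tendsto:
  "(\<lambda>n. real (lo_rank n r u) / n) \<longlonglongrightarrow> max 0 (u - r)"
proof -
  define x where "x n = (u - r) * (real n - 1) + 1" for n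
  have "(\<lambda>n. (of_int \<lceil>x n\<rceil> - 1) / real n) \<longlonglongrightarrow> u - r"
  proof (rule tendsto_sandwich)
    show "(\<lambda>n. (x n - 1) / real n) \<longlonglongrightarrow> u - r" "(\<lambda>n. x n / real n) \<longlonglongrightarrow> u - r"
      unfolding x_def by real_asymp+
    show "eventually (\<lambda>n. (x n - 1) / real n \<le> (of_int \<lceil>x n\<rceil> - 1) / real n) sequentially"
      by (intro always_eventually allI divide_right_mono) linarith+
    show "eventually (\<lambda>n. (of_int \<lceil>x n\<rceil> - 1) / real n \<le> x n / real n) sequentially"
      by (intro always_eventually allI divide_right_mono) linarith+
  qed
  hence "(\<lambda>n. max 0 ((of_int \<lceil>x n\<rceil> - 1) / real n)) \<longlonglongrightarrow> max 0 (u - r)"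
    by (intro tendsto_max tendsto_const)
  moreover have "max 0 ((of_int \<lceil>x n\<rceil> - 1) / real n) = real (lo_rank n r u) / n" for n
  proof -
    \<comment> \<open>Truncation by \<open>nat\<close> is the source of \<open>max 0\<close> in the
      limit.\<close>
    have "real (nat k) = max 0 (of_int k)" for k by simp
    thus ?thesis
      by (simp add: lo_rank_def x_def[symmetric] max_divide_distrib_right)
  qed
  ultimately show ?thesis by simp
qed

section \<open>Integration over the uniform variable\<close>

text \<open>The average over permutations is a finite sum, so it can be exchanged with the integral
  over \<open>u\<close>. With \<open>u\<close> outermost, dominated convergence applies.\<close>

lemma wm_cdf_eq_integral:
  fixes r :: real
  assumes P: "ntp_dist n P" and n: "n \<ge> 1"
  defines "D \<equiv> (\<lambda>u. measure_pmf.expectation (rperm n)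
      (\<lambda>\<sigma>. of_bool (Y_dif n u \<sigma> (watermark_token n P u \<sigma>) \<le> r)))"
  shows "D \<in> borel_measurable borel" "wm_cdf n P r = (\<integral>u. D u \<partial>unif)"
proof -
  interpret prob_space unif by (rule prob_space_unif)
  let ?S = "\<lambda>\<sigma>. {u. Y_dif n u \<sigma> (watermark_token n P u \<sigma>) \<le> r}"
  have S: "?S \<sigma> \<in> sets borel" if "\<sigma> \<in> perms n" for \<sigma>
  proof -
    note [measurable] = measurable_Y_dif_watermark[OF P that n]
    show ?thesis by measurable
  qed
  have D: "D = (\<lambda>u. (\<Sum>\<sigma>\<in>perms n. indicator (?S \<sigma>) u) / card (perms n))"
    by (simp add: D_def integral_pmf_of_set indicator_def)
  show "D \<in> borel_measurable borel"
    unfolding D using S by (intro borel_measurable_divide borel_measurable_sum borel_measurable_indicator) auto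
  have "(\<integral>u. D u \<partial>unif) = (\<Sum>\<sigma>\<in>perms n. \<integral>u. indicator (?S \<sigma>) u \<partial>unif) / card (perms n)"
    unfolding D using S by (subst Bochner_Integration.integral_sum[symmetric]) (auto simp: integrable_indicator_iff emeasure_eq_measure)
  also have "\<dots> = wm_cdf n P r"
    by (simp add: wm_cdf_def integral_pmf_of_set)
  finally show "wm_cdf n P r = (\<integral>u. D u \<partial>unif)" ..
qed

text \<open>Passes from the Lebesgue integral to the gauge integral, where piecewise computation is
  convenient; the endpoints carry no mass.\<close>

lemma integral_unif:
  fixes f :: "real \<Rightarrow> real"
  assumes [measurable]: "f \<in> borel_measurable borel" and bound: "\<And>x. x \<in> {0<..<1} \<Longrightarrow> \<bar>f x\<bar> \<le> B"
    and I: "(f has_integral I) {0..1}"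
  shows "(\<integral>u. f u \<partial>unif) = I"
proof -
  have "unif = density lborel (\<lambda>x. ennreal (indicator {0<..<1} x))"
    by (simp add: uniform_measure_def divide_ennreal_def ennreal_indicator)
  hence "(\<integral>u. f u \<partial>unif) = (LINT x:{0<..<1}|lborel. f x)"
    by (simp add: integral_density set_lebesgue_integral_def)
  also have "\<dots> = integral {0<..<1} f"
  proof (rule set_borel_integral_eq_integral(2))
    show "set_integrable lborel {0<..<1} f"
      unfolding set_integrable_def
      by (rule integrableI_bounded_set[where A = "{0<..<1}" and B = B])
         (use bound in \<open>auto simp: indicator_def\<close>)
  qed
  also have "\<dots> = I"
    using I by (simp add: integral_unique has_integral_Icc_iff_Ioo)
  finally show ?thesis .
qed

text \<open>The integrand is 1 up to \<open>c\<close>, then \<open>u + r\<close> up to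
  \<open>1 - r\<close>, then 1 again. The break point \<open>c\<close> solves
  \<open>u = \<Delta> * (u + r)\<close>, and \<open>c + r = r'\<close> collapses the sum.\<close>

lemma limit_tail_upper_has_integral:
  fixes \<Delta> r :: real
  assumes \<Delta>: "0 \<le> \<Delta>" "\<Delta> < 1" and r: "0 \<le> r" "r \<le> 1 - \<Delta>"
  defines "r' \<equiv> r / (1 - \<Delta>)"
  shows "((\<lambda>u. limit_tail \<Delta> (min 1 (u + r)) u) has_integral (r' + (1 - r'\<^sup>2) / 2)) {0..1}"
proof -
  define c where "c = \<Delta> * r'"
  have r': "r = (1 - \<Delta>) * r'" "0 \<le> r'" "r' \<le> 1"
    using \<Delta> r by (auto simp: r'_def)
  have c: "0 \<le> c" "c + r = r'" "(1 - \<Delta>) * c = \<Delta> * r"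
    using \<Delta> r'(2) by (simp_all add: c_def r'(1) algebra_simps)
  let ?f = "\<lambda>u. limit_tail \<Delta> (min 1 (u + r)) u"
  \<comment> \<open>On each piece the closed form may fail at endpoints, where strict inequalities
    become equalities; the spike sets remove them.\<close>
  have "(?f has_integral c) {0..c}"
  proof (rule has_integral_spike_finite[where S = "{c}"])
    show "((\<lambda>u. 1) has_integral c) {0..c}"
      using has_integral_const_real[of "1::real" 0 c] c by simp
    fix u assume u: "u \<in> {0..c} - {c}"
    hence "(1 - \<Delta>) * u < (1 - \<Delta>) * c" using \<Delta> by simp
    hence "u < \<Delta> * (u + r)" using c by (simp add: algebra_simps)
    moreover have "u + r \<le> 1" using u c r' by simp
    ultimately show "?f u = 1" by (simp add: limit_tail_def)
  qed simp
  moreover have "(?f has_integral (((1 - r)\<^sup>2 - c\<^sup>2) / 2 + (1 - r - c) * r)) {c..1 - r}"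
  proof (rule has_integral_spike_finite[where S = "{c, 1 - r}"])
    show "((\<lambda>u. u + r) has_integral (((1 - r)\<^sup>2 - c\<^sup>2) / 2 + (1 - r - c) * r)) {c..1 - r}"
      using c r' has_integral_const_real[of r c "1 - r"]
      by (intro has_integral_add ident_has_integral) auto
    fix u assume u: "u \<in> {c..1 - r} - {c, 1 - r}"
    hence "(1 - \<Delta>) * c \<le> (1 - \<Delta>) * u" using \<Delta> by simp
    hence "\<not> u < \<Delta> * (u + r)" using c by (simp add: algebra_simps)
    moreover have "(1 - \<Delta>) * u < (1 - \<Delta>) * 1" using \<Delta> u r by (intro mult_strict_left_mono) auto
    hence "u < \<Delta> * (u + r) + (1 - \<Delta>)"
      using mult_nonneg_nonneg[OF \<Delta>(1) r(1)] by (simp add: algebra_simps)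
    ultimately show "?f u = u + r" using u by (simp add: limit_tail_def)
  qed simp
  ultimately have "(?f has_integral (c + (((1 - r)\<^sup>2 - c\<^sup>2) / 2 + (1 - r - c) * r))) {0..1 - r}"
    by (rule has_integral_combine[rotated 2]) (use c r'(2,3) r in auto)
  moreover have "(?f has_integral r) {1 - r..1}"
  proof (rule has_integral_spike_finite[where S = "{1}"])
    show "((\<lambda>u. 1) has_integral r) {1 - r..1}"
      using has_integral_const_real[of "1::real" "1 - r" 1] r by simp
    fix u assume "u \<in> {1 - r..1} - {1}"
    thus "?f u = 1" by (simp add: limit_tail_def)
  qed simp
  ultimately have "(?f has_integral (c + (((1 - r)\<^sup>2 - c\<^sup>2) / 2 + (1 - r - c) * r) + r)) {0..1}"
    by (rule has_integral_combine[rotated 2]) (use r \<Delta> in auto)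
  also have "c + (((1 - r)\<^sup>2 - c\<^sup>2) / 2 + (1 - r - c) * r) + r = (c + r) + (1 - (c + r)\<^sup>2) / 2"
    by (simp add: power2_eq_square algebra_simps add_divide_distrib diff_divide_distrib)
  finally show ?thesis by (simp add: c)
qed

text \<open>The integrand is 0 up to \<open>r\<close>, then \<open>u - r\<close> up to
  \<open>1 - c\<close>, then 0. The point \<open>1 - c\<close> solves
  \<open>u = \<Delta> * (u - r) + (1 - \<Delta>)\<close>, so the graph bounds a right isosceles
  triangle with legs \<open>1 - r'\<close>.\<close>

lemma limit_tail_lower_has_integral:
  fixes \<Delta> r :: real
  assumes \<Delta>: "0 \<le> \<Delta>" "\<Delta> < 1" and r: "0 \<le> r" "r \<le> 1 - \<Delta>"
  defines "r' \<equiv> r / (1 - \<Delta>)"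
  shows "((\<lambda>u. limit_tail \<Delta> (max 0 (u - r)) u) has_integral ((1 - r')\<^sup>2 / 2)) {0..1}"
proof -
  define c where "c = \<Delta> * r'"
  have r': "r = (1 - \<Delta>) * r'" "0 \<le> r'" "r' \<le> 1"
    using \<Delta> r by (auto simp: r'_def)
  have c: "0 \<le> c" "c + r = r'" "(1 - \<Delta>) * c = \<Delta> * r"
    using \<Delta> r'(2) by (simp_all add: c_def r'(1) algebra_simps)
  let ?f = "\<lambda>u. limit_tail \<Delta> (max 0 (u - r)) u"
  \<comment> \<open>Rules out the first branch of \<open>limit_tail\<close> throughout.\<close>
  have not_less: "\<not> u < \<Delta> * max 0 (u - r)" if "0 \<le> u" for u
    using mult_mono[of \<Delta> 1 "max 0 (u - r)" u] \<Delta> r that by auto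
  have "(?f has_integral 0) {0..r}"
  proof (rule has_integral_spike_finite[where S = "{}"])
    show "((\<lambda>u. 0) has_integral 0) {0..r}" by simp
    fix u assume "u \<in> {0..r} - {}"
    thus "?f u = 0" by (simp add: limit_tail_def max_absorb1)
  qed simp
  moreover have "(?f has_integral (((1 - c)\<^sup>2 - r\<^sup>2) / 2 - (1 - c - r) * r)) {r..1 - c}"
  proof (rule has_integral_spike_finite[where S = "{1 - c}"])
    show "((\<lambda>u. u - r) has_integral (((1 - c)\<^sup>2 - r\<^sup>2) / 2 - (1 - c - r) * r)) {r..1 - c}"
      using c r' has_integral_const_real[of r r "1 - c"]
      by (intro has_integral_diff ident_has_integral) auto
    fix u assume u: "u \<in> {r..1 - c} - {1 - c}"
    hence "(1 - \<Delta>) * u < (1 - \<Delta>) * (1 - c)" using \<Delta> by simp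
    hence "u < \<Delta> * (u - r) + (1 - \<Delta>)" using c by (simp add: algebra_simps)
    thus "?f u = u - r" using u r not_less[of u] by (simp add: limit_tail_def max_absorb2)
  qed simp
  ultimately have "(?f has_integral (0 + (((1 - c)\<^sup>2 - r\<^sup>2) / 2 - (1 - c - r) * r))) {0..1 - c}"
    by (rule has_integral_combine[rotated 2]) (use c r'(2,3) r in auto)
  moreover have "(?f has_integral 0) {1 - c..1}"
  proof (rule has_integral_spike_finite[where S = "{}"])
    show "((\<lambda>u. 0) has_integral 0) {1 - c..1}" by simp
    fix u assume u: "u \<in> {1 - c..1} - {}"
    hence "(1 - \<Delta>) * (1 - c) \<le> (1 - \<Delta>) * u" using \<Delta> by simp
    hence "\<not> u < \<Delta> * (u - r) + (1 - \<Delta>)" using c by (simp add: algebra_simps)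
    moreover have "r \<le> u" "0 \<le> u" using u c r r' by auto
    ultimately show "?f u = 0" using not_less[of u] by (simp add: limit_tail_def max_absorb2)
  qed simp
  ultimately have "(?f has_integral (0 + (((1 - c)\<^sup>2 - r\<^sup>2) / 2 - (1 - c - r) * r) + 0)) {0..1}"
    by (rule has_integral_combine[rotated 2]) (use c r'(2,3) r in auto)
  also have "0 + (((1 - c)\<^sup>2 - r\<^sup>2) / 2 - (1 - c - r) * r) + 0 = (1 - (c + r))\<^sup>2 / 2"
    by (simp add: power2_eq_square algebra_simps add_divide_distrib diff_divide_distrib)
  finally show ?thesis by (simp add: c)
qed

lemma wm_cdf_tendsto:
  fixes \<Delta> r :: real
  assumes \<Delta>: "0 \<le> \<Delta>" "\<Delta> < 1" and r: "0 \<le> r" "r \<le> 1 - \<Delta>"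
    and P: "\<And>n. n \<ge> 2 \<Longrightarrow> ntp_dist n (P n)"
    and top: "(\<lambda>n. kth_largest n (P n) 1) \<longlonglongrightarrow> 1 - \<Delta>"
    and second: "(\<lambda>n. kth_largest n (P n) 2) \<longlonglongrightarrow> 0"
  shows "(\<lambda>n. wm_cdf n (P n) r) \<longlonglongrightarrow> 1 - (1 - r / (1 - \<Delta>))\<^sup>2"
proof -
  interpret prob_space unif by (rule prob_space_unif)
  define D where "D n u = measure_pmf.expectation (rperm n)
      (\<lambda>\<sigma>. of_bool (Y_dif n u \<sigma> (watermark_token n (P n) u \<sigma>) \<le> r) :: real)" for n u
  define g where "g u = limit_tail \<Delta> (min 1 (u + r)) u - limit_tail \<Delta> (max 0 (u - r)) u" for u
  have g [measurable]: "g \<in> borel_measurable borel"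
    unfolding g_def limit_tail_def by measurable
  have D: "D n \<in> borel_measurable borel" "wm_cdf n (P n) r = (\<integral>u. D n u \<partial>unif)" if "n \<ge> 2" for n
    using wm_cdf_eq_integral[OF P[OF that], of r] that unfolding D_def by auto
  \<comment> \<open>The excluded points are where \<open>u\<close> can meet a jump:
    \<open>\<Delta>\<close> and \<open>\<Delta> * r / (1 - \<Delta>)\<close> for the lower jump at
    the upper threshold, the other two for the upper jump at the lower threshold. The remaining two
    jumps are never met inside the unit interval.\<close>
  have lim: "(\<lambda>n. D n u) \<longlonglongrightarrow> g u"
    if u: "u \<in> {0<..<1}" "u \<notin> {\<Delta>, 1 - \<Delta>, \<Delta> * r / (1 - \<Delta>), 1 - \<Delta> * r / (1 - \<Delta>)}" for u
  proof -
    have c: "(1 - \<Delta>) * u \<noteq> \<Delta> * r" "(1 - \<Delta>) * (1 - u) \<noteq> \<Delta> * r"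
      using u \<Delta> by (auto simp: field_simps)
    have upper: "u \<noteq> \<Delta> * min 1 (u + r)"
      using c u by (auto simp: min_def algebra_simps)
    have "\<Delta> * (1 - min 1 (u + r)) \<le> \<Delta> * (1 - u)"
      using \<Delta> u r by (intro mult_left_mono) auto
    also have "\<dots> < 1 * (1 - u)"
      using \<Delta> u by (intro mult_strict_right_mono) auto
    finally have upper': "u \<noteq> \<Delta> * min 1 (u + r) + (1 - \<Delta>)"
      by (simp add: algebra_simps)
    have "\<Delta> * max 0 (u - r) \<le> \<Delta> * u"
      using \<Delta> u r by (intro mult_left_mono) auto
    also have "\<dots> < 1 * u"
      using \<Delta> u by (intro mult_strict_right_mono) auto
    finally have lower: "u \<noteq> \<Delta> * max 0 (u - r)" by simp
    have lower': "u \<noteq> \<Delta> * max 0 (u - r) + (1 - \<Delta>)"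
      using c u by (auto simp: max_def algebra_simps)
    have "(\<lambda>n. tail_prob n (P n) u (hi_rank n r u)) \<longlonglongrightarrow> limit_tail \<Delta> (min 1 (u + r)) u"
      by (rule tail_prob_tendsto[OF P top second _ hi_rank_tendsto upper upper'])
         (use u r in \<open>auto simp: hi_rank_def\<close>)
    moreover have "(\<lambda>n. tail_prob n (P n) u (lo_rank n r u)) \<longlonglongrightarrow> limit_tail \<Delta> (max 0 (u - r)) u"
      by (rule tail_prob_tendsto[OF P top second lo_rank_le_hi_rank(2) lo_rank_tendsto lower lower'])
         (use u r in auto)
    ultimately have "(\<lambda>n. tail_prob n (P n) u (hi_rank n r u) - tail_prob n (P n) u (lo_rank n r u))
        \<longlonglongrightarrow> g u"
      unfolding g_def by (rule tendsto_diff)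
    moreover have "eventually (\<lambda>n. tail_prob n (P n) u (hi_rank n r u) - tail_prob n (P n) u (lo_rank n r u)
        = D n u) sequentially"
      using eventually_ge_at_top[of 2]
    proof eventually_elim
      case (elim n)
      have "tail_prob n (P n) u (hi_rank n r u) - tail_prob n (P n) u (lo_rank n r u) =
          measure_pmf.expectation (rperm n) (\<lambda>\<sigma>. of_bool (u \<le> rank_mass n (P n) \<sigma> (hi_rank n r u))
            - of_bool (u \<le> rank_mass n (P n) \<sigma> (lo_rank n r u)))"
        by (subst Bochner_Integration.integral_diff) auto
      also have "\<dots> = D n u"
        unfolding D_def
      proof (rule expectation_rperm_cong)
        fix \<sigma> assume \<sigma>: "\<sigma> \<in> perms n"
        \<comment> \<open>The lower threshold event implies the upper one, so the difference of
          indicators is again an indicator.\<close>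
        have "rank_mass n (P n) \<sigma> (lo_rank n r u) \<le> rank_mass n (P n) \<sigma> (hi_rank n r u)"
          using elim r u by (intro rank_mass_mono P lo_rank_le_hi_rank) auto
        thus "of_bool (u \<le> rank_mass n (P n) \<sigma> (hi_rank n r u))
            - of_bool (u \<le> rank_mass n (P n) \<sigma> (lo_rank n r u)) =
            (of_bool (Y_dif n u \<sigma> (watermark_token n (P n) u \<sigma>) \<le> r) :: real)"
          using Y_dif_watermark_le_iff[OF P[OF elim] \<sigma> elim, of u r] u by auto
      qed
      finally show ?case .
    qed
    ultimately show ?thesis by (rule Lim_transform_eventually)
  qed
  \<comment> \<open>The shift by 2 restricts to vocabulary sizes for which \<open>P\<close> is
    assumed to be a distribution.\<close>
  have "(\<lambda>n. \<integral>u. D (n + 2) u \<partial>unif) \<longlonglongrightarrow> (\<integral>u. g u \<partial>unif)"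
  proof (rule integral_dominated_convergence[where w = "\<lambda>_. 1"])
    show "g \<in> borel_measurable unif" "D (n + 2) \<in> borel_measurable unif" for n
      using D(1)[of "n + 2"] g by auto
    have "AE u in lborel. u \<notin> {\<Delta>, 1 - \<Delta>, \<Delta> * r / (1 - \<Delta>), 1 - \<Delta> * r / (1 - \<Delta>)}"
      by (intro AE_not_in finite_imp_null_set_lborel) simp
    hence "AE u in lborel. u \<in> {0<..<1} \<longrightarrow> (\<lambda>n. D n u) \<longlonglongrightarrow> g u"
      by eventually_elim (use lim in blast)
    hence "AE u in unif. (\<lambda>n. D n u) \<longlonglongrightarrow> g u"
      by (rule AE_uniform_measureI[rotated]) simp
    thus "AE u in unif. (\<lambda>n. D (n + 2) u) \<longlonglongrightarrow> g u"
      by eventually_elim (rule LIMSEQ_ignore_initial_segment)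
    have "\<bar>D n u\<bar> \<le> 1" for n u
      unfolding D_def by (intro order_trans[OF integral_abs_bound] measure_pmf.integral_le_const) auto
    thus "AE u in unif. norm (D (n + 2) u) \<le> 1" for n by simp
  qed simp
  hence "(\<lambda>n. wm_cdf (n + 2) (P (n + 2)) r) \<longlonglongrightarrow> (\<integral>u. g u \<partial>unif)"
    by (simp add: D(2))
  hence "(\<lambda>n. wm_cdf n (P n) r) \<longlonglongrightarrow> (\<integral>u. g u \<partial>unif)"
    by (rule LIMSEQ_offset)
  also have "(\<integral>u. g u \<partial>unif) = (r / (1 - \<Delta>) + (1 - (r / (1 - \<Delta>))\<^sup>2) / 2) - (1 - r / (1 - \<Delta>))\<^sup>2 / 2"
  proof (rule integral_unif[where B = 2])
    show "(g has_integral (r / (1 - \<Delta>) + (1 - (r / (1 - \<Delta>))\<^sup>2) / 2) - (1 - r / (1 - \<Delta>))\<^sup>2 / 2) {0..1}"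
      unfolding g_def
      by (intro has_integral_diff limit_tail_upper_has_integral limit_tail_lower_has_integral \<Delta> r)
    fix u :: real assume u: "u \<in> {0<..<1}"
    have lt: "0 \<le> limit_tail \<Delta> a u" "limit_tail \<Delta> a u \<le> 1" if "0 \<le> a" "a \<le> 1" for a
      using that by (auto simp: limit_tail_def)
    show "\<bar>g u\<bar> \<le> 2"
      using lt[of "min 1 (u + r)"] lt[of "max 0 (u - r)"] u r by (simp add: g_def abs_le_iff)
  qed simp
  also have "(r / (1 - \<Delta>) + (1 - (r / (1 - \<Delta>))\<^sup>2) / 2) - (1 - r / (1 - \<Delta>))\<^sup>2 / 2
      = 1 - (1 - r / (1 - \<Delta>))\<^sup>2"
  proof -
    have "(x + (1 - x\<^sup>2) / 2) - (1 - x)\<^sup>2 / 2 = 1 - (1 - x)\<^sup>2" for x :: real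
      by (simp add: power2_eq_square algebra_simps add_divide_distrib diff_divide_distrib)
    thus ?thesis .
  qed
  finally show ?thesis .
qed

section \<open>Verifying the hypotheses of the limit law\<close>

text \<open>A sorted list is determined by its multiset, here \<open>n - 1\<close> zeros and a
  single one.\<close>

lemma kth_largest_point_mass:
  assumes n: "n \<ge> 2"
  shows "kth_largest n (\<lambda>v. of_bool (v = 1)) 1 = 1" "kth_largest n (\<lambda>v. of_bool (v = 1)) 2 = 0"
proof -
  let ?P = "\<lambda>v. of_bool (v = (1::nat)) :: real"
  have "[1..<Suc n] = 1 # [2..<Suc n]"
    using n by (simp add: upt_conv_Cons numeral_2_eq_2 One_nat_def del: upt_Suc)
  moreover have "map ?P [2..<Suc n] = replicate (n - 1) 0"
    by (rule replicate_eqI) (auto simp del: upt_Suc)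
  ultimately have "mset (map ?P [1..<Suc n]) = mset (replicate (n - 1) 0 @ [1])"
    by (simp del: upt_Suc)
  hence "sort (map ?P [1..<Suc n]) = replicate (n - 1) 0 @ [1]"
    by (intro properties_for_sort) (simp_all add: sorted_append sorted_replicate del: upt_Suc)
  hence "rev (sort (map ?P [1..<Suc n])) = 1 # replicate (n - 1) 0"
    by simp
  thus "kth_largest n ?P 1 = 1" "kth_largest n ?P 2 = 0"
    using n by (auto simp: kth_largest_def One_nat_def simp del: upt_Suc)
qed

text \<open>Since \<open>exp 1 \<le> 3\<close>, the logarithm is at least 1 from
  \<open>n = 3\<close> on, so the product dominates \<open>x\<close> in absolute value.\<close>

lemma tendsto_zero_of_ln_mult:
  fixes x :: "nat \<Rightarrow> real"
  assumes "(\<lambda>n. ln (real n) * x n) \<longlonglongrightarrow> 0"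
  shows "x \<longlonglongrightarrow> 0"
proof (rule Lim_null_comparison)
  show "(\<lambda>n. \<bar>ln (real n) * x n\<bar>) \<longlonglongrightarrow> 0"
    using assms by (rule tendsto_rabs_zero)
  have "1 * \<bar>x n\<bar> \<le> \<bar>ln (real n)\<bar> * \<bar>x n\<bar>" if "n \<ge> 3" for n
  proof (rule mult_right_mono)
    have "exp 1 \<le> real n" using exp_le that by linarith
    hence "1 \<le> ln (real n)" using that by (simp add: ln_ge_iff)
    thus "1 \<le> \<bar>ln (real n)\<bar>" by simp
  qed simp
  thus "eventually (\<lambda>n. norm (x n) \<le> \<bar>ln (real n) * x n\<bar>) sequentially"
    by (intro eventually_sequentiallyI[of 3]) (simp add: abs_mult)
qed

theorem theorem4p1:
  shows
  "(\<forall>(M :: nat \<Rightarrow> 'a measure) U \<pi> w.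
      (\<forall>n\<ge>2. model_H0 n (M n) (U n) (\<pi> n) (w n)) \<longrightarrow>
      (\<forall>r\<in>{0..1}.
         (\<lambda>n. cdf_Y_dif n (M n) (U n) (\<pi> n) (w n) r) \<longlonglongrightarrow> 1 - (1 - r)\<^sup>2))
   \<and>
   (\<forall>(\<Delta> :: real) (P :: nat \<Rightarrow> nat \<Rightarrow> real) (M :: nat \<Rightarrow> 'b measure) U \<pi> w.
      0 \<le> \<Delta> \<longrightarrow> \<Delta> < 1 \<longrightarrow>
      (\<forall>n\<ge>2. ntp_dist n (P n)) \<longrightarrow>
      (\<lambda>n. kth_largest n (P n) 1) \<longlonglongrightarrow> 1 - \<Delta> \<longrightarrow>
      (\<lambda>n. ln (real n) * kth_largest n (P n) 2) \<longlonglongrightarrow> 0 \<longrightarrow>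
      (\<forall>n\<ge>2. model_H1 n (P n) (M n) (U n) (\<pi> n) (w n)) \<longrightarrow>
      (\<forall>r\<in>{0..1 - \<Delta>}.
         (\<lambda>n. cdf_Y_dif n (M n) (U n) (\<pi> n) (w n) r)
           \<longlonglongrightarrow> 1 - (1 - r / (1 - \<Delta>))\<^sup>2))"
proof (intro conjI allI impI ballI)
  fix M :: "nat \<Rightarrow> 'a measure" and U \<pi> w and r :: real
  assume H0: "\<forall>n\<ge>2. model_H0 n (M n) (U n) (\<pi> n) (w n)" and r: "r \<in> {0..1}"
  let ?P = "\<lambda>v. of_bool (v = (1::nat)) :: real"
  \<comment> \<open>The null law is that of a point mass, whose two largest coordinates are 1 and 0,
    so the limit law applies with \<open>\<Delta> = 0\<close>.\<close>
  have "(\<lambda>n. wm_cdf n ?P r) \<longlonglongrightarrow> 1 - (1 - r / (1 - 0))\<^sup>2"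
  proof (rule wm_cdf_tendsto)
    show "ntp_dist n ?P" if "n \<ge> 2" for n
      using that by (intro ntp_dist_point_mass) simp
    show "(\<lambda>n. kth_largest n ?P 1) \<longlonglongrightarrow> 1 - 0" "(\<lambda>n. kth_largest n ?P 2) \<longlonglongrightarrow> 0"
      using kth_largest_point_mass
      by (auto intro!: tendsto_eventually eventually_sequentiallyI[of 2])
  qed (use r in auto)
  moreover have "eventually (\<lambda>n. wm_cdf n ?P r = cdf_Y_dif n (M n) (U n) (\<pi> n) (w n) r) sequentially"
    using eventually_ge_at_top[of 2] by eventually_elim (use H0 in \<open>simp add: cdf_Y_dif_H0\<close>)
  ultimately have "(\<lambda>n. cdf_Y_dif n (M n) (U n) (\<pi> n) (w n) r) \<longlonglongrightarrow> 1 - (1 - r / (1 - 0))\<^sup>2"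
    by (rule Lim_transform_eventually)
  thus "(\<lambda>n. cdf_Y_dif n (M n) (U n) (\<pi> n) (w n) r) \<longlonglongrightarrow> 1 - (1 - r)\<^sup>2"
    by simp
next
  fix \<Delta> :: real and P :: "nat \<Rightarrow> nat \<Rightarrow> real" and M :: "nat \<Rightarrow> 'b measure" and U \<pi> w and r :: real
  assume \<Delta>: "0 \<le> \<Delta>" "\<Delta> < 1" and P: "\<forall>n\<ge>2. ntp_dist n (P n)"
    and top: "(\<lambda>n. kth_largest n (P n) 1) \<longlonglongrightarrow> 1 - \<Delta>"
    and second: "(\<lambda>n. ln (real n) * kth_largest n (P n) 2) \<longlonglongrightarrow> 0"
    and H1: "\<forall>n\<ge>2. model_H1 n (P n) (M n) (U n) (\<pi> n) (w n)" and r: "r \<in> {0..1 - \<Delta>}"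
  have "(\<lambda>n. wm_cdf n (P n) r) \<longlonglongrightarrow> 1 - (1 - r / (1 - \<Delta>))\<^sup>2"
    using \<Delta> r P top tendsto_zero_of_ln_mult[OF second] by (intro wm_cdf_tendsto) auto
  moreover have "eventually (\<lambda>n. wm_cdf n (P n) r = cdf_Y_dif n (M n) (U n) (\<pi> n) (w n) r) sequentially"
    using eventually_ge_at_top[of 2] by eventually_elim (use H1 P in \<open>auto intro!: cdf_Y_dif_H1[symmetric]\<close>)
  ultimately show "(\<lambda>n. cdf_Y_dif n (M n) (U n) (\<pi> n) (w n) r) \<longlonglongrightarrow> 1 - (1 - r / (1 - \<Delta>))\<^sup>2"
    by (rule Lim_transform_eventually)
qed

end
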